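(* Let $(T,v),(T',w)$ be geodesically complete rooted $\mathbb{R}$-trees and let $f:end(T,v)\to end(T',w)$ be a uniformly continuous map between their end spaces. Then the induced map $\hat f:T\to T'$ is Lipschitz of constant $1$, i.e. $d(\hat f(x),\hat f(x'))\le d(x,x')$ for all $x,x'\in T$.
   Context: An $\mathbb{R}$-tree is a metric space $(T,d)$ that is uniquely arcwise connected and such that for all $x,y\in T$ the unique arc from $x$ to $y$ is isometric to $[0,d(x,y)]\subset\mathbb{R}$. A rooted $\mathbb{R}$-tree $(T,v)$ is an $\mathbb{R}$-tree with a chosen point $v$ (the root). It is geodesically complete if every isometric embedding $g:[0,t]\to T$, $t>0$, with $g(0)=v$ extends to an isometric embedding $[0,\infty)\to T$. The end space is $end(T,v)=\{F:[0,\infty)\to T \mid F \text{ is an isometric embedding}, F(0)=v\}$ with the ultrametric $d_e(F,G)=0$ if $F=G$, and $d_e(F,G)=e^{-t_0}$ with $t_0=\sup\{t\ge 0: F(t)=G(t)\}$ if $F\neq G$; it has diameter $\le 1$. Construction of $\lambda$ from $f$: put $\varrho(\delta)=\sup\{d_e(f(F),f(G)) : d_e(F,G)\le\delta\}$ for $\delta\ge0$. For a function $\varrho$ and $x_1<x_2$, $x=tx_1+(1-t)x_2$ with $t\in[0,1]$, let $\varrho_{x_1,x_2}(x)=t\varrho(x_1)+(1-t)\varrho(x_2)$, and let $\omega(x)=\sup\{\varrho_{x_1,x_2}(x) : 0\le x_1<x_2,\ x\in[x_1,x_2]\}$. If $\omega(1)=1$ put $\lambda=\omega|_{[0,1]}$.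 If $\omega(1)<1$, let $\varrho'(t)=\omega(t)$ for $t\in[0,1)$, $\varrho'(1)=1$, and let $\lambda(x)=\sup\{\varrho'_{x_1,x_2}(x): 0\le x_1<x_2\le 1,\ x\in[x_1,x_2]\}$ for $x\in[0,1]$. Then $\lambda:[0,1]\to[0,1]$ is continuous, concave, non-decreasing, $\lambda(0)=0$, $\lambda(1)=1$, and $d_e(f(F),f(G))\le\lambda(d_e(F,G))$ for all $F,G\in end(T,v)$. Definition of $\hat f$: for $x\in T$ let $F\in end(T,v)$ and $t\in[0,\infty)$ with $x=F(t)$ (necessarily $t=d(v,x)$), and put $\hat f(x)=f(F)\big(-\ln(\lambda(e^{-t}))\big)$. This does not depend on the choice of $F$. *)

theory Defs
  imports "HOL-Analysis.Analysis"
begin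

section \<open>Rooted real trees\<close>

definition isometric_embedding ::
    "'a::metric_space set \<Rightarrow> 'b::metric_space set \<Rightarrow> ('a \<Rightarrow> 'b) \<Rightarrow> bool" where
  "isometric_embedding S T g \<longleftrightarrow>
     g ` S \<subseteq> T \<and> (\<forall>s\<in>S. \<forall>t\<in>S. dist (g s) (g t) = dist s t)"

definition isometric_sets :: "'a::metric_space set \<Rightarrow> 'b::metric_space set \<Rightarrow> bool" where
  "isometric_sets S T \<longleftrightarrow> (\<exists>g. isometric_embedding S T g \<and> g ` S = T)"

text \<open>An arc is identified with its image, so that uniqueness is up to reparametrization.\<close>

definition arc_between :: "'a::metric_space set \<Rightarrow> 'a \<Rightarrow> 'a \<Rightarrow> 'a set \<Rightarrow> bool" where
  "arc_between T x y A \<longleftrightarrow>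
     (\<exists>g. arc g \<and> path_image g = A \<and> A \<subseteq> T \<and> pathstart g = x \<and> pathfinish g = y)"

text \<open>Only distinct endpoints matter: \<^const>\<open>arc\<close> is injective, and the degenerate arc
  from a point to itself is that point.\<close>

definition real_tree :: "'a::metric_space set \<Rightarrow> bool" where
  "real_tree T \<longleftrightarrow>
     (\<forall>x\<in>T. \<forall>y\<in>T. x \<noteq> y \<longrightarrow>
        (\<exists>!A. arc_between T x y A) \<and>
        (\<forall>A. arc_between T x y A \<longrightarrow> isometric_sets {0..dist x y} A))"

definition rooted_real_tree :: "'a::metric_space set \<Rightarrow> 'a \<Rightarrow> bool" where
  "rooted_real_tree T v \<longleftrightarrow> real_tree T \<and> v \<in> T"

definition geodesically_complete :: "'a::metric_space set \<Rightarrow> 'a \<Rightarrow> bool" where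
  "geodesically_complete T v \<longleftrightarrow>
     (\<forall>(t::real) g. t > 0 \<and> isometric_embedding {0..t} T g \<and> g 0 = v \<longrightarrow>
        (\<exists>h. isometric_embedding {0..} T h \<and> (\<forall>s\<in>{0..t}. h s = g s)))"


section \<open>The end space\<close>

text \<open>Extensionality makes equality of functions on \<open>[0,\<infinity>)\<close> coincide with HOL equality.\<close>

definition end_space :: "'a::metric_space set \<Rightarrow> 'a \<Rightarrow> (real \<Rightarrow> 'a) set" where
  "end_space T v =
     {F. F \<in> extensional {0..} \<and> isometric_embedding {0..} T F \<and> F 0 = v}"

definition end_dist :: "(real \<Rightarrow> 'a) \<Rightarrow> (real \<Rightarrow> 'a) \<Rightarrow> real" where
  "end_dist F G = (if F = G then 0 else exp (- Sup {t. 0 \<le> t \<and> F t = G t}))"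

definition end_metric :: "'a::metric_space set \<Rightarrow> 'a \<Rightarrow> (real \<Rightarrow> 'a) metric" where
  "end_metric T v = metric (end_space T v, end_dist)"

text \<open>In a real tree \<^const>\<open>end_dist\<close> is indeed a metric, so \<^const>\<open>end_metric\<close> has the intended
  carrier and distance.\<close>

lemma end_space_dist:
  assumes "F \<in> end_space T v" "0 \<le> s" "0 \<le> t"
  shows "dist (F s) (F t) = \<bar>s - t\<bar>"
  using assms by (auto simp: end_space_def isometric_embedding_def dist_real_def)

lemma end_space_arc:
  assumes F: "F \<in> end_space T v" and t: "0 < t"
  shows "arc_between T v (F t) (F ` {0..t})"
proof -
  define g where "g = (\<lambda>s. F (t * s))"
  have d: "dist (g x) (g y) = t * \<bar>x - y\<bar>" if "x \<in> {0..1}" "y \<in> {0..1}" for x y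
    using end_space_dist[OF F, of "t * x" "t * y"] that t
    by (simp add: g_def abs_mult flip: right_diff_distrib)
  have "t-lipschitz_on {0..1} g"
    using d t by (auto simp: lipschitz_on_def dist_real_def)
  then have "path g"
    by (simp add: path_def lipschitz_on_continuous_on)
  moreover have "inj_on g {0..1}"
  proof (rule inj_onI)
    fix x y :: real
    assume "x \<in> {0..1}" "y \<in> {0..1}" "g x = g y"
    then show "x = y" using d[of x y] t by simp
  qed
  moreover have "path_image g = F ` {0..t}"
  proof -
    have "(*) t ` {0..1} = {0..t}"
      using t by (simp add: image_mult_atLeastAtMost)
    moreover have "path_image g = F ` ((*) t ` {0..1})"
      by (simp add: path_image_def g_def image_image)
    ultimately show ?thesis by simp
  qed
  moreover have "F ` {0..t} \<subseteq> T" "F 0 = v"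
    using F by (auto simp: end_space_def isometric_embedding_def)
  ultimately show ?thesis
    unfolding arc_between_def arc_def
    by (intro exI[of _ g]) (simp add: g_def pathstart_def pathfinish_def)
qed

lemma end_space_agree:
  assumes T: "real_tree T" and F: "F \<in> end_space T v" and G: "G \<in> end_space T v"
    and eq: "F t = G t" and s: "0 \<le> s" "s \<le> t"
  shows "F s = G s"
proof (cases "t = 0")
  case True
  then show ?thesis using eq s by simp
next
  case False
  then have t: "0 < t" using s by simp
  have F0: "F 0 = v" and G0: "G 0 = v" and FT: "F 0 \<in> T" "F t \<in> T"
    using F G t by (auto simp: end_space_def isometric_embedding_def)
  have "v \<noteq> F t"
    using end_space_dist[OF F, of 0 t] t F0 by auto
  then have "\<exists>!A. arc_between T v (F t) A"
    using T FT F0 unfolding real_tree_def by blast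
  then have "F ` {0..t} = G ` {0..t}"
    using end_space_arc[OF F t] end_space_arc[OF G t] eq by metis
  then obtain r where r: "0 \<le> r" "F s = G r"
    using s by fastforce
  have "s = r"
    using end_space_dist[OF F, of 0 s] end_space_dist[OF G, of 0 r] r s F0 G0 by simp
  then show ?thesis using r by simp
qed

lemma end_space_agree_bounded:
  assumes T: "real_tree T" and F: "F \<in> end_space T v" and G: "G \<in> end_space T v" and "F \<noteq> G"
  shows "bdd_above {t. 0 \<le> t \<and> F t = G t}" "0 \<in> {t. 0 \<le> t \<and> F t = G t}"
proof -
  obtain r where r: "F r \<noteq> G r" using \<open>F \<noteq> G\<close> by blast
  then have "0 \<le> r"
    using F G by (auto simp: end_space_def extensional_def not_le) (metis linorder_not_le)
  show "bdd_above {t. 0 \<le> t \<and> F t = G t}"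
  proof (rule bdd_aboveI)
    fix t assume "t \<in> {t. 0 \<le> t \<and> F t = G t}"
    then show "t \<le> r"
      using end_space_agree[OF T F G, of t r] r \<open>0 \<le> r\<close> by force
  qed
  show "0 \<in> {t. 0 \<le> t \<and> F t = G t}"
    using F G by (simp add: end_space_def)
qed

lemma end_dist_ultra:
  assumes T: "real_tree T"
    and F: "F \<in> end_space T v" and G: "G \<in> end_space T v" and H: "H \<in> end_space T v"
  shows "end_dist F H \<le> max (end_dist F G) (end_dist G H)"
proof (cases "F = G \<or> G = H \<or> F = H")
  case True
  then show ?thesis by (auto simp: end_dist_def le_max_iff_disj)
next
  case False
  define S where "S = (\<lambda>F G :: real \<Rightarrow> 'a. {t. 0 \<le> t \<and> F t = G t})"
  have FG: "bdd_above (S F G)" "0 \<in> S F G" and GH: "bdd_above (S G H)" "0 \<in> S G H"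
    and FH: "bdd_above (S F H)" "0 \<in> S F H"
    using end_space_agree_bounded[OF T F G] end_space_agree_bounded[OF T G H]
      end_space_agree_bounded[OF T F H] False by (simp_all add: S_def)
  have "min (Sup (S F G)) (Sup (S G H)) \<le> Sup (S F H)"
  proof (rule ccontr)
    assume "\<not> ?thesis"
    then have "Sup (S F H) < Sup (S F G)" "Sup (S F H) < Sup (S G H)" by auto
    then obtain a b where a: "a \<in> S F G" "Sup (S F H) < a" and b: "b \<in> S G H" "Sup (S F H) < b"
      using less_cSup_iff[of "S F G"] less_cSup_iff[of "S G H"] FG GH by blast
    have "F (min a b) = G (min a b)"
      using end_space_agree[OF T F G, of a "min a b"] a b by (auto simp: S_def)
    moreover have "G (min a b) = H (min a b)"
      using end_space_agree[OF T G H, of b "min a b"] a b by (auto simp: S_def)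
    ultimately have "min a b \<in> S F H"
      using a b by (auto simp: S_def)
    then have "min a b \<le> Sup (S F H)"
      using FH by (intro cSup_upper)
    then show False using a b by auto
  qed
  then show ?thesis
    using False by (auto simp: end_dist_def S_def max_def min_def split: if_splits)
qed

lemma Metric_space_end_space:
  assumes "real_tree T"
  shows "Metric_space (end_space T v) end_dist"
proof
  fix F G :: "real \<Rightarrow> 'a"
  show "0 \<le> end_dist F G" by (simp add: end_dist_def)
  show "end_dist F G = end_dist G F" by (simp add: end_dist_def eq_commute)
  show "end_dist F G = 0 \<longleftrightarrow> F = G" by (simp add: end_dist_def)
next
  fix F G H
  assume FGH: "F \<in> end_space T v" "G \<in> end_space T v" "H \<in> end_space T v"
  have "0 \<le> end_dist F G" "0 \<le> end_dist G H" by (simp_all add: end_dist_def)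
  then show "end_dist F H \<le> end_dist F G + end_dist G H"
    using end_dist_ultra[OF assms FGH] by linarith
qed

lemma mspace_end_metric:
  assumes "real_tree T"
  shows "mspace (end_metric T v) = end_space T v"
  unfolding end_metric_def by (rule Metric_space.mspace_metric[OF Metric_space_end_space[OF assms]])

lemma mdist_end_metric:
  assumes "real_tree T"
  shows "mdist (end_metric T v) = end_dist"
  unfolding end_metric_def by (rule Metric_space.mdist_metric[OF Metric_space_end_space[OF assms]])


section \<open>The map induced by a map between end spaces\<close>

text \<open>In what follows \<open>E\<close> is the domain (an end space) of \<open>f\<close>.\<close>

definition end_modulus ::
    "(real \<Rightarrow> 'a) set \<Rightarrow> ((real \<Rightarrow> 'a) \<Rightarrow> (real \<Rightarrow> 'b)) \<Rightarrow> real \<Rightarrow> real" where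
  "end_modulus E f \<delta> =
     Sup {end_dist (f F) (f G) | F G. F \<in> E \<and> G \<in> E \<and> end_dist F G \<le> \<delta>}"

text \<open>Supremum at \<open>x\<close> of all chords of \<open>r\<close> with endpoints \<open>x\<^sub>1 < x\<^sub>2\<close> in \<open>S\<close>.\<close>

definition chord_sup :: "real set \<Rightarrow> (real \<Rightarrow> real) \<Rightarrow> real \<Rightarrow> real" where
  "chord_sup S r x =
     Sup {t * r x1 + (1 - t) * r x2 | t x1 x2.
       x1 \<in> S \<and> x2 \<in> S \<and> x1 < x2 \<and> 0 \<le> t \<and> t \<le> 1 \<and> x = t * x1 + (1 - t) * x2}"

text \<open>The function \<open>\<lambda>\<close>; only its values on \<open>[0,1]\<close> are meaningful.\<close>

definition end_lambda ::
    "(real \<Rightarrow> 'a) set \<Rightarrow> ((real \<Rightarrow> 'a) \<Rightarrow> (real \<Rightarrow> 'b)) \<Rightarrow> real \<Rightarrow> real" where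
  "end_lambda E f =
     (let \<omega> = chord_sup {0..} (end_modulus E f)
      in if \<omega> 1 = 1 then \<omega> else chord_sup {0..1} (\<lambda>x. if x = 1 then 1 else \<omega> x))"

text \<open>The branch \<open>F\<close> through \<open>x = F t\<close> is chosen arbitrarily.\<close>

definition induced_map ::
    "'a::metric_space set \<Rightarrow> 'a \<Rightarrow> ((real \<Rightarrow> 'a) \<Rightarrow> (real \<Rightarrow> 'b)) \<Rightarrow> 'a \<Rightarrow> 'b" where
  "induced_map T v f x =
     (let (F, t) = (SOME (F, t). F \<in> end_space T v \<and> 0 \<le> t \<and> x = F t)
      in f F (- ln (end_lambda (end_space T v) f (exp (- t)))))"

end

theory Submission
  imports Defs
begin

text \<open>Two points \<open>F t\<close>, \<open>G s\<close> of the tree are joined by an arc through the point \<open>F r = G r\<close> where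
  the two branches separate, so their distance is \<open>(t - r) + (s - r)\<close>. As \<open>\<lambda>\<close> dominates the modulus
  of continuity of \<open>f\<close>, the images \<open>f F\<close> and \<open>f G\<close> still agree at \<open>\<mu> r\<close>, where
  \<open>\<mu> t = - ln (\<lambda> (exp (- t)))\<close>. It remains to see that \<open>\<mu>\<close> is \<open>1\<close>-Lipschitz, for which
  monotonicity of \<open>\<lambda>\<close> and \<open>c * \<lambda> x \<le> \<lambda> (c * x)\<close>, for \<open>c\<close> in \<open>[0,1]\<close>, suffice.\<close>

section \<open>Suprema of chords\<close>

lemma chord_le:
  fixes r :: "real \<Rightarrow> real"
  assumes "\<And>x. x \<in> S \<Longrightarrow> r x \<le> B" "x1 \<in> S" "x2 \<in> S" "0 \<le> t" "t \<le> 1"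
  shows "t * r x1 + (1 - t) * r x2 \<le> B"
  using assms by (intro convex_bound_le) auto

lemma chord_sup_upper:
  assumes B: "bdd_above (r ` S)"
    and "x1 \<in> S" "x2 \<in> S" "x1 < x2" "0 \<le> t" "t \<le> 1" "x = t * x1 + (1 - t) * x2"
  shows "t * r x1 + (1 - t) * r x2 \<le> chord_sup S r x"
  unfolding chord_sup_def
proof (rule cSup_upper)
  obtain M where "\<And>x. x \<in> S \<Longrightarrow> r x \<le> M"
    using B by (auto simp: bdd_above_def)
  then have "t * r x1 + (1 - t) * r x2 \<le> M"
    if "x1 \<in> S" "x2 \<in> S" "0 \<le> t" "t \<le> 1" for t x1 x2
    using that by (rule chord_le)
  then show "bdd_above {t * r x1 + (1 - t) * r x2 | t x1 x2.
       x1 \<in> S \<and> x2 \<in> S \<and> x1 < x2 \<and> 0 \<le> t \<and> t \<le> 1 \<and> x = t * x1 + (1 - t) * x2}"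
    by (intro bdd_aboveI[of _ M]) blast
qed (use assms in blast)

text \<open>The point \<open>x\<close> is itself an endpoint of a chord, with coefficient 1 or 0.
  \<open>y\<close> supplies the other endpoint, on whichever side of \<open>x\<close> it
  lies.\<close>

lemma chord_sup_ge:
  assumes B: "bdd_above (r ` S)" and "x \<in> S" "y \<in> S" "x \<noteq> y"
  shows "r x \<le> chord_sup S r x"
proof (cases "x < y")
  case True
  then show ?thesis using chord_sup_upper[OF B, of x y 1 x] assms by simp
next
  case False
  then show ?thesis using chord_sup_upper[OF B, of y x 0 x] assms by simp
qed

lemma chord_sup_least:
  fixes x :: real
  assumes "x \<in> S" "y \<in> S" "x \<noteq> y"
    and le: "\<And>t x1 x2. x1 \<in> S \<Longrightarrow> x2 \<in> S \<Longrightarrow> x1 < x2 \<Longrightarrow> 0 \<le> t \<Longrightarrow> t \<le> 1 \<Longrightarrow>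
      x = t * x1 + (1 - t) * x2 \<Longrightarrow> t * r x1 + (1 - t) * r x2 \<le> C"
  shows "chord_sup S r x \<le> C"
  unfolding chord_sup_def
proof (rule cSup_least)
  obtain t x1 x2 where "x1 \<in> S" "x2 \<in> S" "x1 < x2" "0 \<le> t" "t \<le> 1" "x = t * x1 + (1 - t) * x2"
  proof (cases "x < y")
    case True
    then show ?thesis using that[of x y 1] assms(1,2) by simp
  next
    case False
    then show ?thesis using that[of y x 0] assms(1-3) by simp
  qed
  then show "{t * r x1 + (1 - t) * r x2 | t x1 x2.
       x1 \<in> S \<and> x2 \<in> S \<and> x1 < x2 \<and> 0 \<le> t \<and> t \<le> 1 \<and> x = t * x1 + (1 - t) * x2} \<noteq> {}"
    by blast
qed (use le in blast)

lemma chord_sup_le: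
  fixes x :: real
  assumes "\<And>x. x \<in> S \<Longrightarrow> r x \<le> B" and "x \<in> S" "y \<in> S" "x \<noteq> y"
  shows "chord_sup S r x \<le> B"
  using assms(2-4)
proof (rule chord_sup_least)
  fix t x1 x2 :: real assume "x1 \<in> S" "x2 \<in> S" "0 \<le> t" "t \<le> 1"
  then show "t * r x1 + (1 - t) * r x2 \<le> B" by (intro chord_le assms)
qed

lemma ex_convex_coeff:
  fixes x :: real
  assumes "x1 < x2" "x1 \<le> x" "x \<le> x2"
  obtains t where "0 \<le> t" "t \<le> 1" "x = t * x1 + (1 - t) * x2"
proof
  show "0 \<le> (x2 - x) / (x2 - x1)" "(x2 - x) / (x2 - x1) \<le> 1"
    using assms by auto
  have "(x2 - x) / (x2 - x1) * (x2 - x1) = x2 - x"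
    using assms by simp
  then show "x = (x2 - x) / (x2 - x1) * x1 + (1 - (x2 - x) / (x2 - x1)) * x2"
    unfolding right_diff_distrib left_diff_distrib by linarith
qed

text \<open>A chord is described here by the line \<open>a * x + b\<close> through its endpoints
  rather than by a coefficient \<open>t\<close>. Slope and intercept then become visible, and one
  line can be evaluated at several points.\<close>

lemma chord_sup_upper_line:
  assumes B: "bdd_above (r ` S)"
    and S: "x1 \<in> S" "x2 \<in> S" "x1 < x2" "x1 \<le> x" "x \<le> x2"
    and "r x1 = a * x1 + b" "r x2 = a * x2 + b"
  shows "a * x + b \<le> chord_sup S r x"
proof -
  obtain t where t: "0 \<le> t" "t \<le> 1" "x = t * x1 + (1 - t) * x2"
    using ex_convex_coeff S by blast
  have "a * x + b = t * r x1 + (1 - t) * r x2"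
    unfolding assms(7,8) by (subst t(3)) (simp add: algebra_simps)
  then show ?thesis using chord_sup_upper[OF B, of x1 x2 t x] S t by simp
qed

lemma chord_sup_least_line:
  fixes x :: real
  assumes "x \<in> S" "y \<in> S" "x \<noteq> y"
    and le: "\<And>x1 x2 a b. x1 \<in> S \<Longrightarrow> x2 \<in> S \<Longrightarrow> x1 < x2 \<Longrightarrow> x1 \<le> x \<Longrightarrow> x \<le> x2 \<Longrightarrow>
      r x1 = a * x1 + b \<Longrightarrow> r x2 = a * x2 + b \<Longrightarrow> a * x + b \<le> C"
  shows "chord_sup S r x \<le> C"
  using assms(1-3)
proof (rule chord_sup_least)
  fix t x1 x2 assume *: "x1 \<in> S" "x2 \<in> S" "x1 < x2" "0 \<le> t" "t \<le> 1" "x = t * x1 + (1 - t) * x2"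
  define a where "a = (r x2 - r x1) / (x2 - x1)"
  define b where "b = r x1 - a * x1"
  have "a * (x2 - x1) = r x2 - r x1"
    using * by (simp add: a_def)
  then have r: "r x1 = a * x1 + b" "r x2 = a * x2 + b"
    by (simp_all add: b_def algebra_simps)
  \<comment> \<open>The lower bound is the convexity bound for the negated points.\<close>
  have "x1 \<le> x" "x \<le> x2"
    using * convex_bound_le[of x1 x2 x2 t "1 - t"] convex_bound_le[of "- x1" "- x1" "- x2" t "1 - t"]
    by simp_all
  then have "a * x + b \<le> C" using le[OF *(1-3) _ _ r] by simp
  moreover have "a * x + b = t * r x1 + (1 - t) * r x2"
    unfolding r by (subst *(6)) (simp add: algebra_simps)
  ultimately show "t * r x1 + (1 - t) * r x2 \<le> C" by simp
qed

text \<open>Chords of a monotone function have slope \<open>a \<ge> 0\<close>. If \<open>y\<close>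
  still lies under the chord over \<open>x\<close>, moving along that chord does not decrease the
  value; if \<open>y\<close> is beyond \<open>x2\<close>, the chord is bounded by
  \<open>r x2\<close>, hence by \<open>r y\<close>.\<close>

lemma chord_sup_mono:
  assumes B: "bdd_above (r ` S)" and mono: "mono_on S r"
    and xy: "x \<in> S" "y \<in> S" "x \<le> y"
  shows "chord_sup S r x \<le> chord_sup S r y"
proof (cases "x = y")
  case False
  show ?thesis using xy(1,2) False
  proof (rule chord_sup_least_line)
    fix x1 x2 a b
    assume *: "x1 \<in> S" "x2 \<in> S" "x1 < x2" "x1 \<le> x" "x \<le> x2"
      "r x1 = a * x1 + b" "r x2 = a * x2 + b"
    have "r x1 \<le> r x2" using mono_onD[OF mono *(1,2)] *(3) by simp
    then have "0 \<le> a * (x2 - x1)" using * by (simp add: algebra_simps)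
    then have a: "0 \<le> a" using \<open>x1 < x2\<close> by (simp add: zero_le_mult_iff)
    show "a * x + b \<le> chord_sup S r y"
    proof (cases "y \<le> x2")
      case True
      then have "a * y + b \<le> chord_sup S r y"
        using * xy by (intro chord_sup_upper_line[OF B, of x1 x2]) auto
      then show ?thesis using mult_left_mono[OF xy(3) a] by linarith
    next
      case le: False
      then have "a * x + b \<le> r x2" using * mult_left_mono[OF \<open>x \<le> x2\<close> a] by simp
      also have "\<dots> \<le> r y" using mono_onD[OF mono *(2) xy(2)] le by simp
      also have "\<dots> \<le> chord_sup S r y"
        using xy False by (intro chord_sup_ge[OF B, of y x]) auto
      finally show ?thesis .
    qed
  qed
qed simp

text \<open>A chord on \<open>[x\<^sub>1, x\<^sub>2]\<close> whose line passes below the origin lies below the chord on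
  \<open>[0, x\<^sub>2]\<close>; otherwise scaling it by \<open>c\<close> keeps it below itself, and below the chord on \<open>[0, x\<^sub>1]\<close>
  once \<open>c * x < x\<^sub>1\<close>.\<close>

lemma chord_sup_scale:
  assumes B: "bdd_above (r ` S)"
    and 0: "0 \<in> S" "r 0 = 0" and S: "\<And>x. x \<in> S \<Longrightarrow> 0 \<le> x"
    and x: "x \<in> S" "0 < x" and c: "0 < c" "c \<le> 1"
  shows "c * chord_sup S r x \<le> chord_sup S r (c * x)"
proof -
  have cx: "0 \<le> c * x" "c * x \<le> x"
    using x c by (simp_all add: mult_le_cancel_right1)
  \<comment> \<open>This is the chord from the origin to \<open>y\<close>, evaluated at
    \<open>c * x\<close>. It serves with \<open>y = x2\<close> when \<open>b \<le> 0\<close>, and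
    with \<open>y = x1\<close> when \<open>b > 0\<close> and \<open>c * x < x1\<close>.\<close>
  have origin: "c * (r y / y * x) \<le> chord_sup S r (c * x)" if "y \<in> S" "c * x \<le> y" for y
  proof -
    have "0 < y" using that x c by (smt (verit) mult_pos_pos)
    then have "r y / y * (c * x) + 0 \<le> chord_sup S r (c * x)"
      using that 0 cx by (intro chord_sup_upper_line[OF B, of 0 y]) auto
    then show ?thesis by (simp add: mult_ac)
  qed
  have "chord_sup S r x \<le> chord_sup S r (c * x) / c"
    using x(1) 0(1) less_imp_neq[OF x(2), symmetric]
  proof (rule chord_sup_least_line)
    fix x1 x2 a b
    assume *: "x1 \<in> S" "x2 \<in> S" "x1 < x2" "x1 \<le> x" "x \<le> x2"
      "r x1 = a * x1 + b" "r x2 = a * x2 + b"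
    have x1: "0 \<le> x1" using S * by simp
    have "c * (a * x + b) \<le> chord_sup S r (c * x)"
    proof (cases "b \<le> 0")
      case True
      have "x / x2 \<le> 1" using * x1 by simp
      then have "b \<le> b * (x / x2)"
        using True by (metis mult.right_neutral mult_left_mono_neg)
      moreover have "r x2 / x2 * x = a * x + b * (x / x2)"
        using * x1 by (simp add: field_simps)
      ultimately have "a * x + b \<le> r x2 / x2 * x" by simp
      then have "c * (a * x + b) \<le> c * (r x2 / x2 * x)"
        using c by (intro mult_left_mono) auto
      also have "\<dots> \<le> chord_sup S r (c * x)"
        using * cx by (intro origin) auto
      finally show ?thesis .
    next
      case b: False
      show ?thesis
      proof (cases "x1 \<le> c * x")
        case True
        have "c * b \<le> b" using b c by (simp add: mult_le_cancel_right1)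
        then have "c * (a * x + b) \<le> a * (c * x) + b"
          by (simp add: algebra_simps)
        also have "\<dots> \<le> chord_sup S r (c * x)"
          using * cx True by (intro chord_sup_upper_line[OF B, of x1 x2]) auto
        finally show ?thesis .
      next
        case False
        then have "0 < x1" using cx by linarith
        then have "1 \<le> x / x1" using * by simp
        then have "b \<le> b * (x / x1)"
          using b mult_left_mono[of 1 "x / x1" b] by simp
        moreover have "r x1 / x1 * x = a * x + b * (x / x1)"
          using * \<open>0 < x1\<close> by (simp add: field_simps)
        ultimately have "a * x + b \<le> r x1 / x1 * x" by simp
        then have "c * (a * x + b) \<le> c * (r x1 / x1 * x)"
          using c by (intro mult_left_mono) auto
        also have "\<dots> \<le> chord_sup S r (c * x)"
          using * False by (intro origin) auto
        finally show ?thesis .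
      qed
    qed
    then show "a * x + b \<le> chord_sup S r (c * x) / c"
      using c by (simp add: field_simps)
  qed
  then show ?thesis using c by (simp add: field_simps)
qed

text \<open>As \<open>S\<close> contains no negative points, a chord over 0 must start at 0, so its
  value there is \<open>r 0\<close>.\<close>

lemma chord_sup_0:
  assumes "0 \<in> S" "y \<in> S" "0 < y" and S: "\<And>x. x \<in> S \<Longrightarrow> 0 \<le> x"
    and "r 0 = 0" and B: "bdd_above (r ` S)"
  shows "chord_sup S r 0 = 0"
proof (rule antisym)
  show "chord_sup S r 0 \<le> 0"
    using assms(1,2) less_imp_neq[OF assms(3)]
  proof (rule chord_sup_least_line)
    fix x1 x2 a b
    assume "x1 \<in> S" "x1 \<le> 0" "r x1 = a * x1 + b"
    then show "a * 0 + b \<le> 0" using S[of x1] \<open>r 0 = 0\<close> by simp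
  qed
  show "0 \<le> chord_sup S r 0"
    using chord_sup_ge[OF B, of 0 y] assms by simp
qed

section \<open>The function \<open>\<lambda>\<close>\<close>

lemma end_dist_le_1:
  assumes "real_tree T" "F \<in> end_space T v" "G \<in> end_space T v"
  shows "end_dist F G \<le> 1"
proof (cases "F = G")
  case False
  have "0 \<le> Sup {t. 0 \<le> t \<and> F t = G t}"
    by (intro cSup_upper end_space_agree_bounded[OF assms False])
  then show ?thesis using False by (simp add: end_dist_def)
qed (simp add: end_dist_def)

text \<open>Two distinct branches agree exactly on a closed interval: the agreement set is closed
  downwards, and its supremum is attained because branches are continuous. This translates between
  end distances and agreement at a depth, in both trees.\<close>

lemma end_dist_le_iff:
  assumes T: "real_tree T" and F: "F \<in> end_space T v" and G: "G \<in> end_space T v" and t: "0 \<le> t"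
  shows "end_dist F G \<le> exp (- t) \<longleftrightarrow> F t = G t"
proof (cases "F = G")
  case False
  define S where "S = {t. 0 \<le> t \<and> F t = G t}"
  note bdd = end_space_agree_bounded[OF T F G False, folded S_def]
  have "0 \<le> Sup S" using bdd by (intro cSup_upper)
  \<comment> \<open>The branches agree at some \<open>s\<close> within \<open>e / 2\<close> of the
    supremum, and each of them moves by less than \<open>e / 2\<close> from there.\<close>
  have "dist (F (Sup S)) (G (Sup S)) \<le> 0 + e" if e: "0 < e" for e
  proof -
    obtain s where s: "s \<in> S" "Sup S - e / 2 < s"
      using less_cSup_iff[of S "Sup S - e / 2"] bdd e by auto
    have "s \<le> Sup S" using s bdd by (intro cSup_upper)
    moreover have "dist (F (Sup S)) (G (Sup S)) \<le> dist (F (Sup S)) (F s) + dist (G s) (G (Sup S))"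
      using s dist_triangle[of "F (Sup S)" "G (Sup S)" "F s"] by (simp add: S_def)
    ultimately show ?thesis
      using end_space_dist[OF F \<open>0 \<le> Sup S\<close>, of s] end_space_dist[OF G _ \<open>0 \<le> Sup S\<close>, of s] s
      by (simp add: S_def)
  qed
  then have "dist (F (Sup S)) (G (Sup S)) \<le> 0"
    by (rule field_le_epsilon)
  then have eq: "F (Sup S) = G (Sup S)" by simp
  have "t \<le> Sup S \<longleftrightarrow> F t = G t"
    using end_space_agree[OF T F G eq t] cSup_upper[of t S] bdd t by (auto simp: S_def)
  then show ?thesis using False by (simp add: end_dist_def S_def)
qed (simp add: end_dist_def)

section \<open>The modulus of continuity and its majorant \<lambda>\<close>

locale end_map =
  fixes T :: "'a::metric_space set" and v :: 'a
    and T' :: "'b::metric_space set" and w :: 'b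
    and f :: "(real \<Rightarrow> 'a) \<Rightarrow> (real \<Rightarrow> 'b)"
  assumes T: "real_tree T" and T': "real_tree T'"
    and f: "f ` end_space T v \<subseteq> end_space T' w"
    and nonempty: "end_space T v \<noteq> {}"
begin

abbreviation "E \<equiv> end_space T v"
abbreviation "modulus \<equiv> end_modulus E f"
abbreviation "lam \<equiv> end_lambda E f"

lemma dist_f_le_1: "F \<in> E \<Longrightarrow> G \<in> E \<Longrightarrow> end_dist (f F) (f G) \<le> 1"
  using f by (intro end_dist_le_1[OF T']) auto

lemma modulus_set_nonempty:
  "0 \<le> \<delta> \<Longrightarrow> {end_dist (f F) (f G) | F G. F \<in> E \<and> G \<in> E \<and> end_dist F G \<le> \<delta>} \<noteq> {}"
  \<comment> \<open>A diagonal pair \<open>F = G\<close> has distance 0 and is admissible for every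
    \<open>\<delta> \<ge> 0\<close>.\<close>
  using nonempty by (fastforce simp: end_dist_def)

lemma modulus_set_bdd_above:
  "bdd_above {end_dist (f F) (f G) | F G. F \<in> E \<and> G \<in> E \<and> end_dist F G \<le> \<delta>}"
  by (rule bdd_aboveI[of _ 1]) (use dist_f_le_1 in blast)

lemma modulus_upper:
  "F \<in> E \<Longrightarrow> G \<in> E \<Longrightarrow> end_dist F G \<le> \<delta> \<Longrightarrow> end_dist (f F) (f G) \<le> modulus \<delta>"
  unfolding end_modulus_def by (rule cSup_upper[OF _ modulus_set_bdd_above]) blast

lemma modulus_le_1: "0 \<le> \<delta> \<Longrightarrow> modulus \<delta> \<le> 1"
  unfolding end_modulus_def
  by (rule cSup_least[OF modulus_set_nonempty]) (use dist_f_le_1 in auto)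

lemma modulus_0: "modulus 0 = 0"
proof (rule antisym)
  show "modulus 0 \<le> 0"
    unfolding end_modulus_def
    by (rule cSup_least[OF modulus_set_nonempty]) (auto simp: end_dist_def split: if_splits)
  obtain F where "F \<in> E" using nonempty by blast
  then show "0 \<le> modulus 0"
    using modulus_upper[of F F 0] by (simp add: end_dist_def)
qed

lemma modulus_mono: "mono_on {0..} modulus"
proof (rule mono_onI)
  fix x y :: real assume "x \<in> {0..}" "x \<le> y"
  then show "modulus x \<le> modulus y"
    unfolding end_modulus_def
    by (intro cSup_subset_mono modulus_set_nonempty modulus_set_bdd_above) (auto intro: order_trans)
qed

text \<open>In either case of its definition, \<open>lam\<close> is a chord supremum of a bounded
  monotone function vanishing at 0, so the general results on chords apply. They are applied to both
  candidates \<open>\<omega>\<close> and \<open>\<kappa>\<close> before the cases are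
  merged.\<close>

lemma lam_properties:
  shows lam_1: "lam 1 = 1"
    and lam_ge_modulus: "\<And>x. 0 \<le> x \<Longrightarrow> x \<le> 1 \<Longrightarrow> modulus x \<le> lam x"
    and lam_mono: "\<And>x y. 0 \<le> x \<Longrightarrow> x \<le> y \<Longrightarrow> y \<le> 1 \<Longrightarrow> lam x \<le> lam y"
    and lam_scale: "\<And>c x. 0 < c \<Longrightarrow> c \<le> 1 \<Longrightarrow> 0 < x \<Longrightarrow> x \<le> 1 \<Longrightarrow> c * lam x \<le> lam (c * x)"
proof -
  define \<omega> where "\<omega> = chord_sup {0..} modulus"
  have B: "\<And>x. x \<in> {0..} \<Longrightarrow> modulus x \<le> 1" using modulus_le_1 by simp
  then have bdd: "bdd_above (modulus ` {0..})" by (intro bdd_aboveI2[of _ _ 1])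
  have \<omega>_0: "\<omega> 0 = 0"
    unfolding \<omega>_def by (rule chord_sup_0[where y = 1]) (use modulus_0 bdd in auto)
  have \<omega>_le_1: "\<omega> x \<le> 1" if "0 \<le> x" for x
    unfolding \<omega>_def by (rule chord_sup_le[where y = "x + 1"]) (use B that in auto)
  have \<omega>_ge: "modulus x \<le> \<omega> x" if "0 \<le> x" for x
    unfolding \<omega>_def by (rule chord_sup_ge[where y = "x + 1"]) (use bdd that in auto)
  have \<omega>_mono: "\<omega> x \<le> \<omega> y" if "0 \<le> x" "x \<le> y" for x y
    unfolding \<omega>_def by (rule chord_sup_mono) (use bdd modulus_mono that in auto)
  have \<omega>_scale: "c * \<omega> x \<le> \<omega> (c * x)" if "0 < c" "c \<le> 1" "0 < x" for c x
    unfolding \<omega>_def by (rule chord_sup_scale) (use bdd modulus_0 that in auto)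
  \<comment> \<open>Raising the value at 1 to 1 preserves monotonicity, since
    \<open>\<omega> \<le> 1\<close>.\<close>
  define \<rho> where "\<rho> = (\<lambda>x::real. if x = 1 then 1 else \<omega> x)"
  define \<kappa> where "\<kappa> = chord_sup {0..1} \<rho>"
  have C: "\<And>x. x \<in> {0..1} \<Longrightarrow> \<rho> x \<le> 1" using \<omega>_le_1 by (simp add: \<rho>_def)
  then have bdd': "bdd_above (\<rho> ` {0..1})" by (intro bdd_aboveI2[of _ _ 1])
  have \<rho>_0: "\<rho> 0 = 0" using \<omega>_0 by (simp add: \<rho>_def)
  have \<rho>_mono: "mono_on {0..1} \<rho>"
    using \<omega>_mono \<omega>_le_1 by (auto simp: \<rho>_def mono_on_def)
  have \<kappa>_ge: "\<rho> x \<le> \<kappa> x" if "0 \<le> x" "x \<le> 1" for x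
    unfolding \<kappa>_def
    by (rule chord_sup_ge[where y = "if x = 0 then 1 else 0"]) (use bdd' that in auto)
  have \<kappa>_1: "\<kappa> 1 = 1"
  proof (rule antisym)
    show "\<kappa> 1 \<le> 1"
      unfolding \<kappa>_def by (rule chord_sup_le[where y = 0]) (use C in auto)
    show "1 \<le> \<kappa> 1" using \<kappa>_ge[of 1] by (simp add: \<rho>_def)
  qed
  have \<kappa>_mono: "\<kappa> x \<le> \<kappa> y" if "0 \<le> x" "x \<le> y" "y \<le> 1" for x y
    unfolding \<kappa>_def by (rule chord_sup_mono) (use bdd' \<rho>_mono that in auto)
  have \<kappa>_scale: "c * \<kappa> x \<le> \<kappa> (c * x)" if "0 < c" "c \<le> 1" "0 < x" "x \<le> 1" for c x
    unfolding \<kappa>_def by (rule chord_sup_scale) (use bdd' \<rho>_0 that in auto)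
  have lam: "lam = (if \<omega> 1 = 1 then \<omega> else \<kappa>)"
    unfolding end_lambda_def Let_def \<omega>_def \<kappa>_def \<rho>_def ..
  show "lam 1 = 1" using \<kappa>_1 by (simp add: lam)
  show "modulus x \<le> lam x" if "0 \<le> x" "x \<le> 1" for x
    using \<omega>_ge[of x] \<kappa>_ge[of x] B[of x] that by (auto simp: lam \<rho>_def split: if_splits)
  show "lam x \<le> lam y" if "0 \<le> x" "x \<le> y" "y \<le> 1" for x y
    using \<omega>_mono \<kappa>_mono that by (simp add: lam)
  show "c * lam x \<le> lam (c * x)" if "0 < c" "c \<le> 1" "0 < x" "x \<le> 1" for c x
    using \<omega>_scale \<kappa>_scale that by (simp add: lam)
qed

text \<open>Scaling the value \<open>lam 1 = 1\<close> down by the factor \<open>x\<close> gives the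
  bound. It makes \<open>lam\<close> positive on \<open>(0,1]\<close>, so that the logarithm in
  \<open>mu\<close> is meaningful.\<close>

lemma lam_ge_id: "0 < x \<Longrightarrow> x \<le> 1 \<Longrightarrow> x \<le> lam x"
  using lam_scale[of x 1] lam_1 by simp

lemma lam_le_1: "0 \<le> x \<Longrightarrow> x \<le> 1 \<Longrightarrow> lam x \<le> 1"
  using lam_mono[of x 1] lam_1 by simp

section \<open>\<lambda> in logarithmic coordinates\<close>

definition mu :: "real \<Rightarrow> real" where
  "mu t = - ln (lam (exp (- t)))"

lemma lam_exp_pos: "0 \<le> t \<Longrightarrow> 0 < lam (exp (- t))"
  by (rule less_le_trans[OF exp_gt_zero lam_ge_id]) auto

lemma exp_minus_mu: "0 \<le> t \<Longrightarrow> exp (- mu t) = lam (exp (- t))"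
  using lam_exp_pos[of t] by (simp add: mu_def)

lemma mu_nonneg: "0 \<le> t \<Longrightarrow> 0 \<le> mu t"
  using lam_exp_pos[of t] lam_le_1[of "exp (- t)"] by (simp add: mu_def)

text \<open>Monotonicity of \<open>lam\<close> gives \<open>mu s \<le> mu t\<close>. Scaling from
  \<open>exp (- s)\<close> by \<open>c = exp (s - t)\<close> gives
  \<open>mu t \<le> mu s + (t - s)\<close>, because products become sums under the
  logarithm.\<close>

lemma mu_lipschitz:
  assumes "0 \<le> s" "s \<le> t"
  shows "\<bar>mu t - mu s\<bar> \<le> t - s"
proof -
  have t: "0 \<le> t" using assms by simp
  have "exp (- mu t) \<le> exp (- mu s)"
    unfolding exp_minus_mu[OF assms(1)] exp_minus_mu[OF t] using assms by (intro lam_mono) auto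
  moreover have "exp (s - t + - mu s) \<le> exp (- mu t)"
    using lam_scale[of "exp (s - t)" "exp (- s)"] assms
    unfolding exp_add exp_minus_mu[OF assms(1)] exp_minus_mu[OF t] by (simp flip: exp_add)
  ultimately show ?thesis unfolding exp_le_cancel_iff by simp
qed

lemma f_agree:
  assumes "F \<in> E" "G \<in> E" "0 \<le> r" "F r = G r"
  shows "f F (mu r) = f G (mu r)"
proof -
  have "end_dist F G \<le> exp (- r)"
    using end_dist_le_iff[OF T] assms by blast
  then have "end_dist (f F) (f G) \<le> modulus (exp (- r))"
    using assms by (intro modulus_upper)
  also have "\<dots> \<le> exp (- mu r)"
    unfolding exp_minus_mu[OF assms(3)] using assms(3) by (intro lam_ge_modulus) auto
  finally show ?thesis
    using end_dist_le_iff[OF T'] f assms mu_nonneg by blast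
qed

end

section \<open>Distances in a rooted tree\<close>

text \<open>Under an isometry of \<open>{0..dist x y}\<close> onto \<open>A\<close>, the parameters
  of \<open>x\<close> and \<open>y\<close> are \<open>dist x y\<close> apart and so are the two ends
  of the interval. The parameter of \<open>z\<close> therefore lies between them.\<close>

lemma real_tree_dist_via_arc:
  assumes T: "real_tree T" and xy: "x \<in> T" "y \<in> T" "x \<noteq> y"
    and A: "arc_between T x y A" and z: "z \<in> A"
  shows "dist x y = dist x z + dist z y"
proof -
  have "isometric_sets {0..dist x y} A"
    using T xy A unfolding real_tree_def by blast
  then obtain g where g: "g ` {0..dist x y} = A"
    "\<And>s t. s \<in> {0..dist x y} \<Longrightarrow> t \<in> {0..dist x y} \<Longrightarrow> dist (g s) (g t) = \<bar>s - t\<bar>"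
    unfolding isometric_sets_def isometric_embedding_def by (auto simp: dist_real_def)
  have "x \<in> A" "y \<in> A"
    using A by (auto simp: arc_between_def)
  then obtain a b c where abc: "a \<in> {0..dist x y}" "b \<in> {0..dist x y}" "c \<in> {0..dist x y}"
    "x = g a" "y = g b" "z = g c"
    using z unfolding g(1)[symmetric] by blast
  then have "dist x y = \<bar>a - b\<bar>" "dist x z = \<bar>a - c\<bar>" "dist z y = \<bar>c - b\<bar>"
    using g(2) by blast+
  then show ?thesis using abc(1-3) by auto
qed

text \<open>The case \<open>a > b\<close> is included so that a branch can also be traversed towards
  the root.\<close>

lemma end_space_arc_path:
  assumes F: "F \<in> end_space T v" and "0 \<le> a" "0 \<le> b" "a \<noteq> b"
  shows "arc (F \<circ> linepath a b)" "path_image (F \<circ> linepath a b) = F ` closed_segment a b"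
proof -
  show im: "path_image (F \<circ> linepath a b) = F ` closed_segment a b"
    by (simp add: path_image_compose)
  have pos: "closed_segment a b \<subseteq> {0..}"
    using assms by (auto simp: closed_segment_eq_real_ivl split: if_splits)
  have "1-lipschitz_on {0..} F"
    using end_space_dist[OF F] by (auto simp: lipschitz_on_def dist_real_def)
  then have "continuous_on (closed_segment a b) F"
    using lipschitz_on_continuous_on continuous_on_subset pos by blast
  then have "path (F \<circ> linepath a b)"
    by (intro path_continuous_image) auto
  moreover have "inj_on F {0..}"
  proof (rule inj_onI)
    fix x y :: real
    assume "x \<in> {0..}" "y \<in> {0..}" "F x = F y"
    then show "x = y" using end_space_dist[OF F, of x y] by simp
  qed
  then have "inj_on (F \<circ> linepath a b) {0..1}"
    using arc_linepath[OF \<open>a \<noteq> b\<close>] pos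
    by (intro comp_inj_on) (auto simp: arc_def linepath_image_01 intro: inj_on_subset)
  ultimately show "arc (F \<circ> linepath a b)" by (simp add: arc_def)
qed

text \<open>Both parameters equal the distance of the common point from the root.\<close>

lemma end_space_branch_eq:
  assumes F: "F \<in> end_space T v" and G: "G \<in> end_space T v"
    and "0 \<le> a" "0 \<le> b" "F a = G b"
  shows "a = b"
proof -
  have "F 0 = G 0" using F G by (simp add: end_space_def)
  then show ?thesis
    using end_space_dist[OF F, of 0 a] end_space_dist[OF G, of 0 b] assms(3-5) by simp
qed

lemma end_space_dist_branches:
  assumes T: "real_tree T" and F: "F \<in> end_space T v" and G: "G \<in> end_space T v"
    and st: "0 \<le> s" "0 \<le> t"
  obtains r where "0 \<le> r" "r \<le> s" "r \<le> t" "F r = G r" "dist (F t) (G s) = (t - r) + (s - r)"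
\<comment> \<open>If the branches agree up to the smaller parameter, both points lie on a single
  branch and \<open>r = min s t\<close> works. Otherwise they separate strictly before both points,
  and \<open>r\<close> is the last parameter of agreement.\<close>
proof (cases "F (min s t) = G (min s t)")
  case True
  show ?thesis
  proof (rule that[of "min s t"])
    show "dist (F t) (G s) = (t - min s t) + (s - min s t)"
      using True end_space_dist[OF F, of t s] end_space_dist[OF G, of t s] st
      by (cases "s \<le> t") (auto simp: min_def)
  qed (use True st in auto)
next
  case False
  then have "F \<noteq> G" by auto
  define r where "r = Sup {t. 0 \<le> t \<and> F t = G t}"
  have r: "0 \<le> r"
    unfolding r_def by (intro cSup_upper end_space_agree_bounded[OF T F G \<open>F \<noteq> G\<close>])
  have agree: "F a = G a \<longleftrightarrow> a \<le> r" if "0 \<le> a" for a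
    using end_dist_le_iff[OF T F G that] \<open>F \<noteq> G\<close> by (simp add: end_dist_def r_def)
  have lt: "r < s" "r < t" using False agree st by (auto simp: not_le)
  have eq: "F r = G r" using agree r by simp
  let ?p = "F \<circ> linepath t r" and ?q = "G \<circ> linepath r s"
  have p: "arc ?p" "path_image ?p = F ` {r..t}" and q: "arc ?q" "path_image ?q = G ` {r..s}"
    using end_space_arc_path[OF F, of t r] end_space_arc_path[OF G, of r s] r lt
    by (simp_all add: closed_segment_eq_real_ivl)
  \<comment> \<open>A common point has the same parameter on both branches, and beyond
    \<open>r\<close> they disagree. Hence going down \<open>F\<close> to \<open>F r\<close> and up
    \<open>G\<close> is injective.\<close>
  have "F ` {r..t} \<inter> G ` {r..s} \<subseteq> {F r}"
  proof clarsimp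
    fix a b assume ab: "F a = G b" "r \<le> a" "r \<le> b"
    then have "a = b" using end_space_branch_eq[OF F G, of a b] r by simp
    then have "a = r" using agree[of a] ab r by simp
    then show "G b = F r" using ab by simp
  qed
  then have "arc (?p +++ ?q)"
    using p q eq by (intro arc_join) (auto simp: pathstart_def pathfinish_def linepath_def)
  moreover have "F ` {r..t} \<subseteq> T" "G ` {r..s} \<subseteq> T"
    using F G r by (auto simp: end_space_def isometric_embedding_def)
  moreover have im: "path_image (?p +++ ?q) = F ` {r..t} \<union> G ` {r..s}"
    using p q eq by (subst path_image_join) (auto simp: pathstart_def pathfinish_def linepath_def)
  ultimately have A: "arc_between T (F t) (G s) (F ` {r..t} \<union> G ` {r..s})"
    unfolding arc_between_def
    by (intro exI[of _ "?p +++ ?q"]) (auto simp: pathstart_compose pathfinish_compose)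
  have ne: "F t \<noteq> G s"
    using end_space_branch_eq[OF F G st(2,1)] agree st lt by fastforce
  show ?thesis
  proof (rule that[OF r _ _ eq])
    have "F t \<in> T" "G s \<in> T"
      using F G st by (auto simp: end_space_def isometric_embedding_def)
    then have "dist (F t) (G s) = dist (F t) (F r) + dist (F r) (G s)"
      using lt by (intro real_tree_dist_via_arc[OF T _ _ ne A]) auto
    then show "dist (F t) (G s) = (t - r) + (s - r)"
      using end_space_dist[OF F, of t r] end_space_dist[OF G, of r s] r lt eq by simp
  qed (use lt in auto)
qed

text \<open>The arc from \<open>v\<close> to \<open>x\<close> is an isometric copy of
  \<open>{0..dist v x}\<close>, which has positive length and extends to a ray by geodesic
  completeness.\<close>

lemma end_space_through:
  assumes T: "real_tree T" and v: "v \<in> T" and complete: "geodesically_complete T v"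
    and x: "x \<in> T" "x \<noteq> v"
  obtains F where "F \<in> end_space T v" "F (dist v x) = x"
proof -
  obtain A where A: "arc_between T v x A" "isometric_sets {0..dist v x} A"
    using T v x unfolding real_tree_def by metis
  then obtain g where g: "g ` {0..dist v x} = A"
    "\<And>s t. s \<in> {0..dist v x} \<Longrightarrow> t \<in> {0..dist v x} \<Longrightarrow> dist (g s) (g t) = \<bar>s - t\<bar>"
    unfolding isometric_sets_def isometric_embedding_def by (auto simp: dist_real_def)
  have "v \<in> A" "x \<in> A" and AT: "A \<subseteq> T"
    using A by (auto simp: arc_between_def)
  then obtain a b where ab: "a \<in> {0..dist v x}" "b \<in> {0..dist v x}" "v = g a" "x = g b"
    unfolding g(1)[symmetric] by blast
  then have "dist v x = \<bar>a - b\<bar>" using g(2) by blast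
  \<comment> \<open>The isometry onto the arc may run in either direction; in the second case it is
    reversed.\<close>
  then have "a = 0 \<and> b = dist v x \<or> a = dist v x \<and> b = 0"
    using ab(1,2) by auto
  then obtain h where h: "isometric_embedding {0..dist v x} T h" "h 0 = v" "h (dist v x) = x"
  proof
    assume *: "a = 0 \<and> b = dist v x"
    show ?thesis
    proof (rule that)
      show "isometric_embedding {0..dist v x} T g"
        using g AT by (auto simp: isometric_embedding_def dist_real_def)
    qed (use * ab(3,4)[symmetric] in simp_all)
  next
    assume *: "a = dist v x \<and> b = 0"
    show ?thesis
    proof (rule that)
      show "isometric_embedding {0..dist v x} T (\<lambda>s. g (dist v x - s))"
        unfolding isometric_embedding_def
      proof (intro conjI ballI)
        show "(\<lambda>s. g (dist v x - s)) ` {0..dist v x} \<subseteq> T"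
          using g(1) AT by fastforce
        fix s t assume "s \<in> {0..dist v x}" "t \<in> {0..dist v x}"
        then show "dist (g (dist v x - s)) (g (dist v x - t)) = dist s t"
          by (subst g(2)) (auto simp: dist_real_def)
      qed
    qed (use * ab(3,4)[symmetric] in simp_all)
  qed
  obtain k where k: "isometric_embedding {0..} T k" "\<forall>s\<in>{0..dist v x}. k s = h s"
    using complete h x unfolding geodesically_complete_def by (metis zero_less_dist_iff)
  show ?thesis
  proof (rule that)
    \<comment> \<open>Restriction provides the extensionality built into
      \<open>end_space\<close>.\<close>
    show "restrict k {0..} \<in> end_space T v"
      using k h by (auto simp: end_space_def isometric_embedding_def)
    show "restrict k {0..} (dist v x) = x" using k h by simp
  qed
qed

section \<open>The Lipschitz estimate for the induced map\<close>

lemma (in end_map) dist_f_le: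
  assumes F: "F \<in> E" and G: "G \<in> E" and st: "0 \<le> s" "0 \<le> t"
  shows "dist (f F (mu t)) (f G (mu s)) \<le> dist (F t) (G s)"
proof -
  obtain r where r: "0 \<le> r" "r \<le> s" "r \<le> t" "F r = G r" "dist (F t) (G s) = (t - r) + (s - r)"
    using end_space_dist_branches[OF T F G st] .
  have fF: "f F \<in> end_space T' w" and fG: "f G \<in> end_space T' w"
    using f F G by auto
  \<comment> \<open>The detour passes through \<open>f F (mu r) = f G (mu r)\<close>, the image of
    the separation point. Each leg stays on one branch of the target, where distances are parameter
    differences.\<close>
  have "dist (f F (mu t)) (f G (mu s))
      \<le> dist (f F (mu t)) (f F (mu r)) + dist (f G (mu r)) (f G (mu s))"
    unfolding f_agree[OF F G r(1,4), symmetric] by (rule dist_triangle)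
  also have "\<dots> = \<bar>mu t - mu r\<bar> + \<bar>mu r - mu s\<bar>"
    using end_space_dist[OF fF] end_space_dist[OF fG] mu_nonneg r st by simp
  also have "\<dots> \<le> dist (F t) (G s)"
    using mu_lipschitz[OF r(1,2)] mu_lipschitz[OF r(1,3)] r(5) by (simp add: abs_minus_commute)
  finally show ?thesis .
qed

text \<open>This unfolds the choice in \<open>induced_map\<close>. As \<open>dist_f_le\<close> holds
  for all pairs of branches, whichever branch is chosen can be used.\<close>

lemma (in end_map) induced_map_branch:
  assumes "F \<in> E" "0 \<le> t" "x = F t"
  obtains G s where "G \<in> E" "0 \<le> s" "x = G s" "induced_map T v f x = f G (mu s)"
proof -
  let ?P = "\<lambda>(F, t). F \<in> E \<and> 0 \<le> t \<and> x = F t"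
  obtain G s where Gs: "(SOME p. ?P p) = (G, s)" by fastforce
  have "?P (SOME p. ?P p)"
    by (rule someI[of ?P "(F, t)"]) (use assms in simp)
  then have "G \<in> E" "0 \<le> s" "x = G s" by (simp_all add: Gs)
  moreover have "induced_map T v f x = f G (mu s)"
    unfolding induced_map_def Gs by (simp add: mu_def)
  ultimately show ?thesis using that by blast
qed

theorem proposition7p1p11:
  fixes T :: "'a::metric_space set" and v :: 'a
    and T' :: "'b::metric_space set" and w :: 'b
    and f :: "(real \<Rightarrow> 'a) \<Rightarrow> (real \<Rightarrow> 'b)"
  assumes "rooted_real_tree T v" and "geodesically_complete T v"
    and "rooted_real_tree T' w" and "geodesically_complete T' w"
    and "uniformly_continuous_map (end_metric T v) (end_metric T' w) f"
  shows "1-lipschitz_on T (induced_map T v f)"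
proof (rule lipschitz_onI)
  have tree: "real_tree T" "v \<in> T" and tree': "real_tree T'"
    using assms by (auto simp: rooted_real_tree_def)
  have f: "f ` end_space T v \<subseteq> end_space T' w"
    using assms(5) mspace_end_metric[OF tree(1), of v] mspace_end_metric[OF tree', of w]
    by (auto simp: uniformly_continuous_map_def)
  fix x y assume xy: "x \<in> T" "y \<in> T"
  show "dist (induced_map T v f x) (induced_map T v f y) \<le> 1 * dist x y"
  proof (cases "x = y")
    case False
    \<comment> \<open>At least one of the distinct points \<open>x\<close>, \<open>y\<close> differs
      from the root, so a branch through it exists. \<open>H\<close> also provides a branch through
      \<open>v\<close> itself, at parameter 0.\<close>
    then obtain H where H: "H \<in> end_space T v"
      using end_space_through[OF tree assms(2)] xy by metis
    interpret end_map T v T' w f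
      using tree tree' f H by unfold_locales auto
    have branch: "\<exists>F t. F \<in> E \<and> 0 \<le> t \<and> z = F t" if "z \<in> T" for z
    proof (cases "z = v")
      case True
      then have "z = H 0" using H by (simp add: end_space_def)
      then show ?thesis using H by blast
    next
      case False
      then show ?thesis
        using end_space_through[OF tree assms(2) that] by (metis zero_le_dist)
    qed
    obtain F t where F: "F \<in> E" "0 \<le> t" "x = F t" "induced_map T v f x = f F (mu t)"
      using branch[OF xy(1)] induced_map_branch by metis
    obtain G s where G: "G \<in> E" "0 \<le> s" "y = G s" "induced_map T v f y = f G (mu s)"
      using branch[OF xy(2)] induced_map_branch by metis
    show ?thesis
      using dist_f_le[OF F(1) G(1) G(2) F(2)] F(3,4) G(3,4) by simp
  qed simp
qed simp

end
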